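(* Let $\mathscr{Q}=\{(x,y)\in\mathbb{R}^2 : x\ge 0,\ y\ge 0,\ x^2+y^2=1\}$ and let $P=(\alpha,\beta)\in\mathscr{Q}$. The Romik digit expansion $(\alpha,\beta)=[d_1,d_2,\dots]_{\mathscr{Q}}$ of $P$ is eventually periodic if and only if $P$ is defined over a real quadratic field, namely, there exists a squarefree positive integer $D$ such that $\alpha,\beta\in\mathbb{Q}(\sqrt{D})$.
   Context: Romik's map $T:\mathscr{Q}\to\mathscr{Q}$ is \[ T(x,y)=\left(\frac{|2-x-2y|}{3-2x-2y},\ \frac{|2-2x-y|}{3-2x-2y}\right). \] The Romik digit of $(x,y)\in\mathscr{Q}$ is $d(x,y)=1$ if $\tfrac45<x\le 1$, $d(x,y)=2$ if $\tfrac35<x<\tfrac45$, $d(x,y)=3$ if $0\le x<\tfrac35$; at the boundary points both adjacent digits are allowed: $d(\tfrac45,\tfrac35)\in\{1,2\}$ and $d(\tfrac35,\tfrac45)\in\{2,3\}$. The Romik digit expansion of $(x,y)$ is $[d_1,d_2,\dots]_{\mathscr{Q}}$ with $d_j=d(T^{j-1}(x,y))$ for $j\ge1$ (so some points have two expansions). Eventually periodic means there exist $l\ge0$, $k\ge1$ with $d_{j+k}=d_j$ for all $j>l$. *)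

theory Defs
  imports Complex_Main "HOL-Computational_Algebra.Squarefree"
begin

definition quarter_circle :: "(real \<times> real) set" where
  "quarter_circle = {(x, y). x \<ge> 0 \<and> y \<ge> 0 \<and> x\<^sup>2 + y\<^sup>2 = 1}"

definition romik_map :: "real \<times> real \<Rightarrow> real \<times> real" where
  "romik_map = (\<lambda>(x, y).
     (\<bar>2 - x - 2 * y\<bar> / (3 - 2 * x - 2 * y), \<bar>2 - 2 * x - y\<bar> / (3 - 2 * x - 2 * y)))"

text \<open>The digit is a relation rather than a function: at each of the two boundary points both
  adjacent digits are admissible.\<close>

definition is_romik_digit :: "real \<times> real \<Rightarrow> nat \<Rightarrow> bool" where
  "is_romik_digit = (\<lambda>(x, y) k.
     (4/5 < x \<and> x \<le> 1 \<and> k = 1) \<or>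
     (3/5 < x \<and> x < 4/5 \<and> k = 2) \<or>
     (0 \<le> x \<and> x < 3/5 \<and> k = 3) \<or>
     ((x, y) = (4/5, 3/5) \<and> k \<in> {1, 2}) \<or>
     ((x, y) = (3/5, 4/5) \<and> k \<in> {2, 3}))"

text \<open>Digit sequences are indexed from 1; the value at index 0 is irrelevant.\<close>

definition is_romik_expansion :: "real \<times> real \<Rightarrow> (nat \<Rightarrow> nat) \<Rightarrow> bool" where
  "is_romik_expansion P d \<longleftrightarrow> (\<forall>j\<ge>1. is_romik_digit ((romik_map ^^ (j - 1)) P) (d j))"

definition eventually_periodic :: "(nat \<Rightarrow> 'a) \<Rightarrow> bool" where
  "eventually_periodic d \<longleftrightarrow> (\<exists>l k. k \<ge> 1 \<and> (\<forall>j>l. d (j + k) = d j))"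

definition rat_adjoin_sqrt :: "nat \<Rightarrow> real set" where
  "rat_adjoin_sqrt D = {a + b * sqrt (real D) | a b. a \<in> \<rat> \<and> b \<in> \<rat>}"

lemma romik_map_quarter_circle:
  assumes "P \<in> quarter_circle"
  shows "romik_map P \<in> quarter_circle"
proof -
  obtain x y where P: "P = (x, y)" by (cases P)
  have xy: "x \<ge> 0" "y \<ge> 0" "x\<^sup>2 + y\<^sup>2 = 1"
    using assms by (auto simp: P quarter_circle_def)
  have "(x + y)\<^sup>2 + (x - y)\<^sup>2 = 2"
    using xy(3) by (simp add: power2_eq_square algebra_simps)
  then have "(x + y)\<^sup>2 \<le> 2"
    using zero_le_power2[of "x - y"] by linarith
  also have "(2::real) < (3/2)\<^sup>2" by (simp add: power2_eq_square)
  finally have "x + y < 3/2" by (rule power_less_imp_less_base) simp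
  then have pos: "3 - 2 * x - 2 * y > 0" by simp
  have "(2 - x - 2 * y)\<^sup>2 + (2 - 2 * x - y)\<^sup>2 = (3 - 2 * x - 2 * y)\<^sup>2"
    using xy(3) by (simp add: power2_eq_square algebra_simps)
  with pos show ?thesis
    by (simp add: P romik_map_def quarter_circle_def power_divide flip: add_divide_distrib)
qed

lemma is_romik_digit_exists:
  assumes "P \<in> quarter_circle"
  shows "\<exists>k. is_romik_digit P k"
proof -
  obtain x y where P: "P = (x, y)" by (cases P)
  have xy: "x \<ge> 0" "y \<ge> 0" "x\<^sup>2 + y\<^sup>2 = 1"
    using assms by (auto simp: P quarter_circle_def)
  have "x\<^sup>2 \<le> 1\<^sup>2" using xy(3) zero_le_power2[of y] unfolding power_one by linarith
  then have "x \<le> 1" by (rule power2_le_imp_le) simp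
  moreover have "y = 3/5" if "x = 4/5"
  proof (rule power2_eq_imp_eq)
    show "y\<^sup>2 = (3/5)\<^sup>2" using xy(3) that by (simp add: power2_eq_square)
  qed (use xy in auto)
  moreover have "y = 4/5" if "x = 3/5"
  proof (rule power2_eq_imp_eq)
    show "y\<^sup>2 = (4/5)\<^sup>2" using xy(3) that by (simp add: power2_eq_square)
  qed (use xy in auto)
  moreover consider "4/5 < x" | "x = 4/5" | "3/5 < x" "x < 4/5" | "x = 3/5" | "x < 3/5"
    by linarith
  ultimately show ?thesis
    using xy(1) unfolding P is_romik_digit_def by cases auto
qed

lemma is_romik_expansion_exists:
  assumes "P \<in> quarter_circle"
  shows "\<exists>d. is_romik_expansion P d"
proof -
  have "(romik_map ^^ n) P \<in> quarter_circle" for n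
    by (induction n) (simp_all add: assms romik_map_quarter_circle)
  then have "\<forall>j. \<exists>k. is_romik_digit ((romik_map ^^ (j - 1)) P) k"
    by (simp add: is_romik_digit_exists)
  then obtain d where "\<forall>j. is_romik_digit ((romik_map ^^ (j - 1)) P) (d j)"
    by metis
  then show ?thesis unfolding is_romik_expansion_def by blast
qed

end

theory Submission
  imports Defs "HOL-Library.Quadratic_Discriminant"
begin

text \<open>In the coordinate t = y / (1 + x) on [0, 1], Romik's map has three branches, each an integral
  Moebius transformation of determinant 1 or -1, with inverses s / (1 + 2 s), 1 / (2 + s) and
  1 / (2 - s). These inverses contract strictly enough that the digits determine t. Hence a
  periodic tail makes some iterate a fixed point of a nontrivial integral Moebius transformation,
  so t is rational or quadratic.

  Conversely, let t be quadratic and apply the same branches to its conjugate. The conjugate cannot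
  stay in [0, 1], since it would then have the digits of t; once outside it stays outside. From then
  on the integral quadratic polynomials of the iterates have constant discriminant and exactly one
  root in [0, 1], as in Galois' theory of reduced forms, which leaves finitely many of them. So the
  orbit is finite. For rational t the denominators along the orbit do not increase.\<close>

section \<open>Inverse branches and the orbits they generate\<close>

definition inv_branch :: "nat \<Rightarrow> real \<Rightarrow> real" where
  "inv_branch k s = (if k = 1 then s / (1 + 2 * s) else if k = 2 then 1 / (s + 2) else 1 / (2 - s))"

text \<open>Running the recursion backwards through the inverse branches avoids absolute values and
  allows either digit at the boundary values 1/3 and 1/2. The conjugate of an orbit obeys the same
  recursion and can fail only the interval condition.\<close>

definition is_orbit :: "(nat \<Rightarrow> nat) \<Rightarrow> (nat \<Rightarrow> real) \<Rightarrow> bool" where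
  "is_orbit d t \<longleftrightarrow>
     (\<forall>n. d n \<in> {1, 2, 3} \<and> t n \<in> {0..1} \<and> t n = inv_branch (d n) (t (Suc n)))"

lemma is_orbitD:
  assumes "is_orbit d t"
  shows "d n \<in> {1, 2, 3}" "t n \<in> {0..1}" "t n = inv_branch (d n) (t (Suc n))"
  using assms unfolding is_orbit_def by blast+

lemma is_orbit_shift: "is_orbit d t \<Longrightarrow> is_orbit (\<lambda>n. d (n + l)) (\<lambda>n. t (n + l))"
  unfolding is_orbit_def add_Suc by blast

lemma inv_branch_bounds:
  assumes "s \<in> {0..1}"
  shows "inv_branch 1 s \<in> {0..1/3}" "inv_branch 2 s \<in> {1/3..1/2}" "inv_branch 3 s \<in> {1/2..1}"
  using assms by (auto simp: inv_branch_def field_simps)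

lemma inv_branch_in_unit:
  assumes "s \<in> {0..1}" "k \<in> {1, 2, 3}"
  shows "inv_branch k s \<in> {0..1}"
  using inv_branch_bounds[OF assms(1)] assms(2) by auto

text \<open>None of the image intervals [0, 1/3], [1/3, 1/2], [1/2, 1] contains both endpoints of
  [0, 1]. This is what keeps a nonempty composition of branches from being the identity.\<close>

lemma inv_branch_not_onto:
  assumes "s \<in> {0..1}" "s' \<in> {0..1}" "k \<in> {1, 2, 3}" "inv_branch k s = 0"
  shows "inv_branch k s' \<noteq> 1"
  using inv_branch_bounds[OF assms(1)] inv_branch_bounds[OF assms(2)] assms(3,4) by auto

text \<open>Branches 1 and 3 have derivative 1 at their fixed points 0 and 1, so no uniform factor
  below 1 is available. The bound x / (1 + x) for a distance x is the substitute: the reciprocal of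
  a positive distance grows by at least 1.\<close>

lemma inv_branch_contracts:
  assumes s: "s \<in> {0..1}" "s' \<in> {0..1}" and k: "k \<in> {1, 2, 3}"
  shows "\<bar>inv_branch k s - inv_branch k s'\<bar> * (1 + \<bar>s - s'\<bar>) \<le> \<bar>s - s'\<bar>"
proof -
  \<comment> \<open>Here \<open>w\<close> stands for the product of the two denominators; since the
    determinant is 1 or -1, the branch values differ by exactly |s - s'| / w.\<close>
  have *: "\<bar>s - s'\<bar> / w * (1 + \<bar>s - s'\<bar>) \<le> \<bar>s - s'\<bar>" if "1 + \<bar>s - s'\<bar> \<le> w" for w
  proof -
    have "w > 0" using that by linarith
    moreover have "\<bar>s - s'\<bar> * (1 + \<bar>s - s'\<bar>) \<le> \<bar>s - s'\<bar> * w"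
      by (rule mult_left_mono) (use that in auto)
    ultimately show ?thesis by (simp add: field_simps)
  qed
  \<comment> \<open>The first product serves branches 1 and 2; the second serves branch 3, where 2 -
    s is read as 1 + (1 - s).\<close>
  have ss: "s * s' \<ge> 0" "(1 - s) * (1 - s') \<ge> 0" using s by auto
  consider "k = 1" | "k = 2" | "k = 3" using k by auto
  then show ?thesis
  proof cases
    case 1
    have "inv_branch k s - inv_branch k s' = (s - s') / ((1 + 2 * s) * (1 + 2 * s'))"
      using s by (simp add: 1 inv_branch_def field_simps)
    then have "\<bar>inv_branch k s - inv_branch k s'\<bar> = \<bar>s - s'\<bar> / ((1 + 2 * s) * (1 + 2 * s'))"
      using s by (simp add: abs_mult)
    moreover have "1 + \<bar>s - s'\<bar> \<le> (1 + 2 * s) * (1 + 2 * s')"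
      using s ss by (auto simp: algebra_simps abs_if)
    ultimately show ?thesis using * by simp
  next
    case 2
    have "inv_branch k s - inv_branch k s' = (s' - s) / ((s + 2) * (s' + 2))"
      using s by (simp add: 2 inv_branch_def field_simps)
    then have "\<bar>inv_branch k s - inv_branch k s'\<bar> = \<bar>s - s'\<bar> / ((s + 2) * (s' + 2))"
      using s by (simp add: abs_mult)
    moreover have "1 + \<bar>s - s'\<bar> \<le> (s + 2) * (s' + 2)"
      using s ss by (auto simp: algebra_simps abs_if)
    ultimately show ?thesis using * by simp
  next
    case 3
    have "inv_branch k s - inv_branch k s' = (s - s') / ((2 - s) * (2 - s'))"
      using s by (simp add: 3 inv_branch_def field_simps)
    then have "\<bar>inv_branch k s - inv_branch k s'\<bar> = \<bar>s - s'\<bar> / ((2 - s) * (2 - s'))"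
      using s by (simp add: abs_mult)
    moreover have "1 + \<bar>s - s'\<bar> \<le> (2 - s) * (2 - s')"
      using s ss by (auto simp: algebra_simps abs_if)
    ultimately show ?thesis using * by simp
  qed
qed

text \<open>By the contraction bound the distance \<open>x n\<close> of the two orbits is
  nondecreasing in n and gains at least \<open>x n * x (Suc n)\<close>, hence at least the square of
  \<open>x 0\<close>, per step. Two points of [0, 1] cannot drift apart linearly.\<close>

lemma is_orbit_unique:
  assumes t: "is_orbit d t" and u: "is_orbit d u"
  shows "t 0 = u 0"
proof (rule ccontr)
  define x where "x n = \<bar>t n - u n\<bar>" for n
  assume "t 0 \<noteq> u 0"
  then have x0: "x 0 > 0" by (simp add: x_def)
  have step: "x n * (1 + x (Suc n)) \<le> x (Suc n)" for n
    using inv_branch_contracts[of "t (Suc n)" "u (Suc n)" "d n"] t u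
    unfolding x_def is_orbit_def by metis
  have nonneg: "x n \<ge> 0" for n by (simp add: x_def)
  have grow: "x n \<ge> x 0 + real n * (x 0)\<^sup>2" for n
  proof (induction n)
    case (Suc n)
    have "0 \<le> x n * x (Suc n)" by (simp add: nonneg)
    then have *: "x n \<le> x (Suc n)" using step[of n] by (simp add: algebra_simps)
    have "0 \<le> real n * (x 0)\<^sup>2" by simp
    then have "x 0 \<le> x n" using Suc by linarith
    then have "x 0 * x 0 \<le> x n * x (Suc n)"
      using * x0 by (intro mult_mono) auto
    then have "x n + (x 0)\<^sup>2 \<le> x (Suc n)"
      using step[of n] by (simp add: algebra_simps power2_eq_square)
    then show ?case using Suc by (simp add: algebra_simps)
  qed simp
  obtain n where "real n * (x 0)\<^sup>2 > 1"
    using reals_Archimedean3[of "(x 0)\<^sup>2"] x0 by auto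
  moreover have "x n \<le> 1"
    using is_orbitD(2)[OF t, of n] is_orbitD(2)[OF u, of n] by (simp add: x_def abs_le_iff)
  ultimately show False using grow[of n] x0 by linarith
qed

section \<open>Field operations in the rationals with a square root adjoined\<close>

lemma rat_adjoin_sqrtI: "a \<in> \<rat> \<Longrightarrow> b \<in> \<rat> \<Longrightarrow> a + b * sqrt (real D) \<in> rat_adjoin_sqrt D"
  by (auto simp: rat_adjoin_sqrt_def)

lemma Rats_subset_rat_adjoin_sqrt: "a \<in> \<rat> \<Longrightarrow> a \<in> rat_adjoin_sqrt D"
  using rat_adjoin_sqrtI[of a 0 D] by simp

lemma rat_adjoin_sqrt_add:
  assumes "x \<in> rat_adjoin_sqrt D" "y \<in> rat_adjoin_sqrt D"
  shows "x + y \<in> rat_adjoin_sqrt D"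
proof -
  obtain a b a' b' where "x = a + b * sqrt (real D)" "y = a' + b' * sqrt (real D)"
    and r: "a \<in> \<rat>" "b \<in> \<rat>" "a' \<in> \<rat>" "b' \<in> \<rat>"
    using assms by (auto simp: rat_adjoin_sqrt_def)
  then have "x + y = (a + a') + (b + b') * sqrt (real D)" by (simp add: algebra_simps)
  then show ?thesis using r by (auto intro!: rat_adjoin_sqrtI)
qed

lemma rat_adjoin_sqrt_mult:
  assumes "x \<in> rat_adjoin_sqrt D" "y \<in> rat_adjoin_sqrt D"
  shows "x * y \<in> rat_adjoin_sqrt D"
proof -
  obtain a b a' b' where "x = a + b * sqrt (real D)" "y = a' + b' * sqrt (real D)"
    and r: "a \<in> \<rat>" "b \<in> \<rat>" "a' \<in> \<rat>" "b' \<in> \<rat>"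
    using assms by (auto simp: rat_adjoin_sqrt_def)
  then have "x * y = (a * a' + b * b' * real D) + (a * b' + a' * b) * sqrt (real D)"
    by (simp add: algebra_simps)
  then show ?thesis using r by (auto intro!: rat_adjoin_sqrtI)
qed

lemma rat_adjoin_sqrt_diff:
  assumes "x \<in> rat_adjoin_sqrt D" "y \<in> rat_adjoin_sqrt D"
  shows "x - y \<in> rat_adjoin_sqrt D"
  using rat_adjoin_sqrt_add[OF assms(1) rat_adjoin_sqrt_mult[OF _ assms(2), of "-1"]]
  by (simp add: Rats_subset_rat_adjoin_sqrt)

text \<open>The denominator is rationalised with the conjugate a - b sqrt D. As \<open>D\<close> may
  be a square, in which case the conjugate of a nonzero element can vanish, rational sqrt D is split
  off first.\<close>

lemma rat_adjoin_sqrt_inverse: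
  assumes "x \<in> rat_adjoin_sqrt D"
  shows "inverse x \<in> rat_adjoin_sqrt D"
proof -
  obtain a b where x: "x = a + b * sqrt (real D)" and r: "a \<in> \<rat>" "b \<in> \<rat>"
    using assms by (auto simp: rat_adjoin_sqrt_def)
  show ?thesis
  proof (cases "sqrt (real D) \<in> \<rat>")
    case True
    then show ?thesis using x r by (intro Rats_subset_rat_adjoin_sqrt) auto
  next
    case False
    show ?thesis
    proof (cases "a - b * sqrt (real D) = 0")
      case True
      \<comment> \<open>With sqrt D irrational a vanishing conjugate forces b = 0 and a = 0, so
        \<open>x\<close> is 0, whose inverse is 0 by convention.\<close>
      have "b = 0"
      proof (rule ccontr)
        assume "b \<noteq> 0"
        then have "sqrt (real D) = a / b" using True by (simp add: field_simps)
        then show False using False r by simp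
      qed
      then show ?thesis using True x Rats_subset_rat_adjoin_sqrt[of 0] by simp
    next
      case nz: False
      define N where "N = a * a - b * b * real D"
      have "N = x * (a - b * sqrt (real D))" by (simp add: N_def x algebra_simps)
      then have "inverse x = (a - b * sqrt (real D)) / N"
        using nz by (cases "x = 0") (auto simp: field_simps)
      also have "\<dots> = a / N + (- b / N) * sqrt (real D)" by (simp add: diff_divide_distrib)
      also have "\<dots> \<in> rat_adjoin_sqrt D" using r by (intro rat_adjoin_sqrtI) (auto simp: N_def)
      finally show ?thesis .
    qed
  qed
qed

lemma rat_adjoin_sqrt_divide:
  "x \<in> rat_adjoin_sqrt D \<Longrightarrow> y \<in> rat_adjoin_sqrt D \<Longrightarrow> x / y \<in> rat_adjoin_sqrt D"
  by (simp add: divide_inverse rat_adjoin_sqrt_mult rat_adjoin_sqrt_inverse)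

lemmas rat_adjoin_sqrt_field = rat_adjoin_sqrt_add rat_adjoin_sqrt_diff
  rat_adjoin_sqrt_mult rat_adjoin_sqrt_divide

lemma inv_branch_rat_adjoin_sqrt:
  "s \<in> rat_adjoin_sqrt D \<Longrightarrow> inv_branch k s \<in> rat_adjoin_sqrt D"
  unfolding inv_branch_def
  by (auto intro!: rat_adjoin_sqrt_field intro: Rats_subset_rat_adjoin_sqrt)

lemma is_orbit_rat_adjoin_sqrt:
  assumes "is_orbit d t" "t n \<in> rat_adjoin_sqrt D"
  shows "t 0 \<in> rat_adjoin_sqrt D"
  using assms(2)
proof (induction n)
  case (Suc n)
  then show ?case using assms(1) inv_branch_rat_adjoin_sqrt unfolding is_orbit_def by metis
qed

text \<open>Completing the square, r = 2 a x + b squares to the discriminant, whose squarefree part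
  serves as \<open>D\<close>. A rational root takes D = 1.\<close>

lemma quadratic_root_rat_adjoin_sqrt:
  fixes a b c :: int and x :: real
  assumes eq: "of_int a * x\<^sup>2 + of_int b * x + of_int c = 0" and nz: "a \<noteq> 0 \<or> b \<noteq> 0"
  shows "\<exists>D. D > 0 \<and> squarefree D \<and> x \<in> rat_adjoin_sqrt D"
proof (cases "x \<in> \<rat>")
  case True
  then show ?thesis by (intro exI[of _ 1]) (simp add: Rats_subset_rat_adjoin_sqrt)
next
  case False
  have a: "a \<noteq> 0"
  proof
    assume "a = 0"
    then have "x = - of_int c / of_int b" using eq nz by (simp add: field_simps)
    then show False using False by simp
  qed
  define r where "r = 2 * of_int a * x + of_int b"
  define n where "n = nat (b\<^sup>2 - 4 * a * c)"
  have "r\<^sup>2 = of_int (b\<^sup>2 - 4 * a * c) + 4 * of_int a * (of_int a * x\<^sup>2 + of_int b * x + of_int c)"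
    by (simp add: r_def power2_eq_square algebra_simps)
  then have r2: "r\<^sup>2 = of_int (b\<^sup>2 - 4 * a * c)" using eq by simp
  have xr: "x = (r - of_int b) / (2 * of_int a)" using a by (simp add: r_def)
  have "r \<noteq> 0" using xr False by auto
  then have "0 < b\<^sup>2 - 4 * a * c" using r2 by (metis of_int_0_less_iff zero_less_power2)
  then have n: "n > 0" "r\<^sup>2 = real n" using r2 by (auto simp: n_def)
  define D m where "D = squarefree_part n" and "m = square_part n"
  have D: "squarefree D" "D > 0" "n = D * m\<^sup>2"
    using squarefree_decompose[of n] squarefree_part_nonzero[of n] unfolding D_def m_def
    by (auto simp del: squarefree_part_nonzero)
  have "\<bar>r\<bar> = sqrt (real n)" using n(2) by (metis real_sqrt_abs)
  also have "\<dots> = 0 + real m * sqrt (real D)" by (simp add: D real_sqrt_mult)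
  also have "\<dots> \<in> rat_adjoin_sqrt D" by (rule rat_adjoin_sqrtI) auto
  finally have "\<bar>r\<bar> \<in> rat_adjoin_sqrt D" .
  then have "r \<in> rat_adjoin_sqrt D"
    using rat_adjoin_sqrt_mult[of "-1" D "\<bar>r\<bar>"]
    by (auto simp: abs_if Rats_subset_rat_adjoin_sqrt split: if_splits)
  then have "x \<in> rat_adjoin_sqrt D"
    by (subst xr) (auto intro!: rat_adjoin_sqrt_field intro: Rats_subset_rat_adjoin_sqrt)
  then show ?thesis using D by blast
qed

section \<open>Periodic digits give quadratic numbers\<close>

lemma inv_branch_divide:
  assumes "q > 0" "0 \<le> p" "p \<le> q"
  shows "inv_branch 1 (p / q) = p / (q + 2 * p)" "inv_branch 2 (p / q) = q / (p + 2 * q)"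
    "inv_branch 3 (p / q) = q / (2 * q - p)"
proof -
  have "1 + 2 * (p / q) = (q + 2 * p) / q" "p / q + 2 = (p + 2 * q) / q"
    "2 - p / q = (2 * q - p) / q"
    using assms(1) by (simp_all add: field_simps)
  then show "inv_branch 1 (p / q) = p / (q + 2 * p)" "inv_branch 2 (p / q) = q / (p + 2 * q)"
    "inv_branch 3 (p / q) = q / (2 * q - p)"
    using assms(1) by (simp_all add: inv_branch_def)
qed

lemma foldr_inv_branch_in_unit:
  assumes "set ws \<subseteq> {1, 2, 3}" "x \<in> {0..1}"
  shows "foldr inv_branch ws x \<in> {0..1}"
  using assms by (induction ws) (auto simp: inv_branch_in_unit simp del: atLeastAtMost_iff)

text \<open>Prepending a digit multiplies the integer coefficient matrix on the left by that of its
  branch. Positivity of the denominator on [0, 1] is carried through the induction so that nested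
  fractions can be cleared.\<close>

lemma foldr_inv_branch_moebius:
  assumes "set ws \<subseteq> {1, 2, 3}"
  shows "\<exists>a b c e :: int. \<forall>x \<in> {0..1}. of_int c * x + of_int e > (0::real) \<and>
           foldr inv_branch ws x = (of_int a * x + of_int b) / (of_int c * x + of_int e)"
  using assms
proof (induction ws)
  case Nil
  show ?case
    by (rule exI[of _ 1], rule exI[of _ 0], rule exI[of _ 0], rule exI[of _ 1]) simp
next
  case (Cons k ws)
  then obtain a b c e :: int where
    pos: "\<And>x::real. x \<in> {0..1} \<Longrightarrow> of_int c * x + of_int e > 0" and
    eq: "\<And>x. x \<in> {0..1} \<Longrightarrow>
      foldr inv_branch ws x = (of_int a * x + of_int b) / (of_int c * x + of_int e)"
    by (metis set_subset_Cons subset_trans)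
  \<comment> \<open>The value lies in [0, 1] and its denominator is positive, so the numerator lies
    between 0 and the denominator, as \<open>inv_branch_divide\<close> requires.\<close>
  have num: "0 \<le> of_int a * x + of_int b" "of_int a * x + of_int b \<le> of_int c * x + of_int e"
    if "x \<in> {0..1}" for x :: real
    using foldr_inv_branch_in_unit[of ws x] pos[OF that] that Cons.prems
    by (auto simp: eq[OF that] zero_le_divide_iff divide_le_eq)
  consider "k = 1" | "k = 2" | "k = 3" using Cons.prems by auto
  then show ?case
  proof cases
    case 1
    show ?thesis
    proof (rule exI[of _ a], rule exI[of _ b], rule exI[of _ "c + 2 * a"],
        rule exI[of _ "e + 2 * b"], rule ballI)
      fix x :: real assume x: "x \<in> {0..1}"
      show "of_int (c + 2 * a) * x + of_int (e + 2 * b) > 0 \<and> foldr inv_branch (k # ws) x =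
        (of_int a * x + of_int b) / (of_int (c + 2 * a) * x + of_int (e + 2 * b))"
        using pos[OF x] num[OF x] inv_branch_divide(1)[OF pos[OF x] num[OF x]]
        by (simp add: 1 eq[OF x] algebra_simps)
    qed
  next
    case 2
    show ?thesis
    proof (rule exI[of _ c], rule exI[of _ e], rule exI[of _ "a + 2 * c"],
        rule exI[of _ "b + 2 * e"], rule ballI)
      fix x :: real assume x: "x \<in> {0..1}"
      show "of_int (a + 2 * c) * x + of_int (b + 2 * e) > 0 \<and> foldr inv_branch (k # ws) x =
        (of_int c * x + of_int e) / (of_int (a + 2 * c) * x + of_int (b + 2 * e))"
        using pos[OF x] num[OF x] inv_branch_divide(2)[OF pos[OF x] num[OF x]]
        by (simp add: 2 eq[OF x] algebra_simps)
    qed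
  next
    case 3
    show ?thesis
    proof (rule exI[of _ c], rule exI[of _ e], rule exI[of _ "2 * c - a"],
        rule exI[of _ "2 * e - b"], rule ballI)
      fix x :: real assume x: "x \<in> {0..1}"
      show "of_int (2 * c - a) * x + of_int (2 * e - b) > 0 \<and> foldr inv_branch (k # ws) x =
        (of_int c * x + of_int e) / (of_int (2 * c - a) * x + of_int (2 * e - b))"
        using pos[OF x] num[OF x] inv_branch_divide(3)[OF pos[OF x] num[OF x]]
        by (simp add: 3 eq[OF x] algebra_simps)
    qed
  qed
qed

text \<open>Clearing denominators in x = (a x + b) / (c x + e) gives an integral equation of degree
  at most 2; what needs proof is that it is not trivial.\<close>

lemma fixed_point_rat_adjoin_sqrt:
  assumes ws: "set ws \<subseteq> {1, 2, 3}" "ws \<noteq> []" and x: "x \<in> {0..1}" "foldr inv_branch ws x = x"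
  shows "\<exists>D. D > 0 \<and> squarefree D \<and> x \<in> rat_adjoin_sqrt D"
proof -
  obtain a b c e :: int where
    pos: "\<And>x::real. x \<in> {0..1} \<Longrightarrow> of_int c * x + of_int e > 0" and
    eq: "\<And>x. x \<in> {0..1} \<Longrightarrow>
      foldr inv_branch ws x = (of_int a * x + of_int b) / (of_int c * x + of_int e)"
    using foldr_inv_branch_moebius[OF ws(1)] by metis
  have *: "of_int c * x\<^sup>2 + of_int (e - a) * x + of_int (- b) = 0"
    using eq[OF x(1)] pos[OF x(1)] x(2) by (simp add: field_simps power2_eq_square)
  have "c \<noteq> 0 \<or> e - a \<noteq> 0"
  proof (rule ccontr)
    assume "\<not> ?thesis"
    \<comment> \<open>The equation now reads b = 0, so the composition is the identity on [0, 1];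
      its outermost branch would then take both values 0 and 1.\<close>
    then have z: "c = 0" "a = e" "b = 0" using * by auto
    then have id: "foldr inv_branch ws y = y" if "y \<in> {0..1}" for y
      using eq[OF that] pos[OF that] by auto
    obtain k vs where kv: "ws = k # vs" using ws(2) by (cases ws) auto
    have "foldr inv_branch vs y \<in> {0..1}" if "y \<in> {0..1}" for y
      using foldr_inv_branch_in_unit[of vs y] ws(1) that kv by auto
    then show False
      using inv_branch_not_onto[of "foldr inv_branch vs 0" "foldr inv_branch vs 1" k]
        id[of 0] id[of 1] ws(1) kv by auto
  qed
  then show ?thesis using quadratic_root_rat_adjoin_sqrt[OF *] by blast
qed

lemma is_orbit_foldr:
  assumes "is_orbit d t"
  shows "t l = foldr inv_branch (map d [l..<l+k]) (t (l + k))"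
proof (induction k)
  case (Suc k)
  show ?case using Suc is_orbitD(3)[OF assms, of "l + k"] by simp
qed simp

text \<open>The tails starting at \<open>m\<close> and \<open>m + k\<close> have equal digits, hence
  equal first points. So \<open>t m\<close> is fixed by the composition over one period, and the
  field membership travels back to \<open>t 0\<close>.\<close>

lemma eventually_periodic_imp_quadratic:
  assumes orb: "is_orbit d t" and per: "eventually_periodic d"
  shows "\<exists>D. D > 0 \<and> squarefree D \<and> t 0 \<in> rat_adjoin_sqrt D"
proof -
  obtain l k where k: "k \<ge> 1" "\<And>j. j > l \<Longrightarrow> d (j + k) = d j"
    using per by (auto simp: eventually_periodic_def)
  define m where "m = Suc l"
  have "d (n + m) = d (n + (m + k))" for n
    using k(2)[of "n + m"] by (simp add: m_def add.assoc)
  then have "t m = t (m + k)"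
    using is_orbit_unique[of "\<lambda>n. d (n + m)" "\<lambda>n. t (n + m)" "\<lambda>n. t (n + (m + k))"]
      is_orbit_shift[OF orb, of m] is_orbit_shift[OF orb, of "m + k"] by simp
  then have "foldr inv_branch (map d [m..<m+k]) (t m) = t m"
    using is_orbit_foldr[OF orb, of m k] by simp
  moreover have "set (map d [m..<m+k]) \<subseteq> {1, 2, 3}" "t m \<in> {0..1}"
    using is_orbitD(1,2)[OF orb] by auto
  moreover have "map d [m..<m+k] \<noteq> []" using k(1) by simp
  ultimately obtain D where "D > 0" "squarefree D" "t m \<in> rat_adjoin_sqrt D"
    using fixed_point_rat_adjoin_sqrt by metis
  then show ?thesis using is_orbit_rat_adjoin_sqrt[OF orb] by blast
qed

section \<open>Finite orbits have eventually periodic digits\<close>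

text \<open>Distinct branch images meet only in 1/3, reached by branches 1 and 2 from s = 1, and in
  1/2, reached by branches 2 and 3 from s = 0. A point thus determines its successor even where it
  does not determine its digit.\<close>

lemma inv_branch_eq_cases:
  assumes s: "s \<in> {0..1}" "s' \<in> {0..1}" and k: "k \<in> {1, 2, 3}" "k' \<in> {1, 2, 3}"
    and eq: "inv_branch k s = inv_branch k' s'"
  shows "s = s' \<and> (k = k' \<or> inv_branch k s \<in> {1/3, 1/2} \<and> s \<in> {0, 1})"
proof -
  have p: "1 + 2 * s > 0" "1 + 2 * s' > 0" "s + 2 > 0" "s' + 2 > 0" "2 - s > 0" "2 - s' > 0"
    using s by auto
  have one: "k = k' \<Longrightarrow> s = s'"
    using k eq p by (auto simp: inv_branch_def frac_eq_eq algebra_simps)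
  have b13: "s = 1" if "inv_branch 1 s = 1/3" "s \<in> {0..1}" for s
    using that by (auto simp: inv_branch_def field_simps)
  have b23: "s = 1" if "inv_branch 2 s = 1/3" "s \<in> {0..1}" for s
    using that by (auto simp: inv_branch_def field_simps)
  have b22: "s = 0" if "inv_branch 2 s = 1/2" "s \<in> {0..1}" for s
    using that by (auto simp: inv_branch_def field_simps)
  have b32: "s = 0" if "inv_branch 3 s = 1/2" "s \<in> {0..1}" for s
    using that by (auto simp: inv_branch_def field_simps)
  note B = inv_branch_bounds[OF s(1)] inv_branch_bounds[OF s(2)]
  consider "k = k'" | "k = 1" "k' = 2" | "k = 2" "k' = 1" | "k = 2" "k' = 3" | "k = 3" "k' = 2"
    | "k = 1" "k' = 3" | "k = 3" "k' = 1"
    using k by auto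
  then show ?thesis
  proof cases
    case 1 then show ?thesis using one by auto
  next
    case 2
    then have "inv_branch 1 s = 1/3" "inv_branch 2 s' = 1/3" using eq B by auto
    then show ?thesis using b13[of s] b23[of s'] s 2 by auto
  next
    case 3
    then have "inv_branch 2 s = 1/3" "inv_branch 1 s' = 1/3" using eq B by auto
    then show ?thesis using b23[of s] b13[of s'] s 3 by auto
  next
    case 4
    then have "inv_branch 2 s = 1/2" "inv_branch 3 s' = 1/2" using eq B by auto
    then show ?thesis using b22[of s] b32[of s'] s 4 by auto
  next
    case 5
    then have "inv_branch 3 s = 1/2" "inv_branch 2 s' = 1/2" using eq B by auto
    then show ?thesis using b32[of s] b22[of s'] s 5 by auto
  qed (use eq B in auto)
qed

text \<open>Branch 1 sends 0 to 0 and branch 3 sends 1 to 1, and successors are unique. Such an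
  endpoint is where an orbit lands after an ambiguous digit.\<close>

lemma is_orbit_endpoint_fixed:
  assumes orb: "is_orbit d t" and e: "t n = 0 \<or> t n = 1"
  shows "t (n + m) = t n"
proof (induction m)
  case (Suc m)
  let ?k = "d (n + m)" and ?s = "t (Suc (n + m))"
  have s: "?s \<in> {0..1}" "?k \<in> {1, 2, 3}" "t n = inv_branch ?k ?s"
    using is_orbitD[OF orb] Suc by metis+
  have b: "inv_branch 1 0 = 0" "inv_branch 3 1 = 1" by (simp_all add: inv_branch_def)
  show ?case
    using e
  proof
    assume "t n = 0"
    then show ?thesis
      using inv_branch_eq_cases[of ?s 0 ?k 1] s b(1) by simp
  next
    assume "t n = 1"
    then show ?thesis
      using inv_branch_eq_cases[of ?s 1 ?k 3] s b(2) by simp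
  qed
qed simp

text \<open>A repeated value makes \<open>t\<close> periodic because successors are unique. An
  ambiguous digit cannot recur on a periodic orbit, since the orbit is stuck at 0 or 1
  afterwards.\<close>

lemma finite_orbit_imp_eventually_periodic:
  assumes orb: "is_orbit d t" and fin: "finite (t ` {m..})"
  shows "eventually_periodic d"
proof -
  have "\<not> inj_on t {m..}"
    using fin finite_imageD[of t "{m..}"] infinite_Ici by blast
  then obtain i j where ij: "i < j" "t i = t j"
    unfolding inj_on_def by (metis linorder_neqE_nat)
  define p where "p = j - i"
  have p: "p \<ge> 1" "t (i + p) = t i" using ij by (auto simp: p_def)
  note o = is_orbitD[OF orb]
  have cases: "t (Suc n) = t (Suc n') \<and> (d n = d n' \<or> t n \<in> {1/3, 1/2} \<and> t (Suc n) \<in> {0, 1})"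
    if "t n = t n'" for n n'
    using inv_branch_eq_cases[OF o(2)[of "Suc n"] o(2)[of "Suc n'"] o(1)[of n] o(1)[of n']] that
      o(3)[of n] o(3)[of n'] by metis
  have tp: "t (i + n + p) = t (i + n)" for n
  proof (induction n)
    case (Suc n)
    then show ?case using cases[of "i + n + p" "i + n"] by simp
  qed (simp add: p)
  have "d (n + p) = d n" if "n > i" for n
  proof (rule ccontr)
    assume ne: "d (n + p) \<noteq> d n"
    have n: "t (n + p) = t n" using tp[of "n - i"] that by simp
    then have *: "t n \<in> {1/3, 1/2}" "t (Suc n) \<in> {0, 1}" using cases[of n "n + p"] ne by auto
    \<comment> \<open>The index \<open>Suc n + (p - 1)\<close> is \<open>n + p\<close>, so the value
      there would be 0 or 1 and also \<open>t n\<close>, which is 1/3 or 1/2.\<close>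
    then have "t (Suc n + (p - 1)) = t (Suc n)"
      by (intro is_orbit_endpoint_fixed[OF orb]) auto
    then show False using * n p(1) by auto
  qed
  then show ?thesis using p(1) unfolding eventually_periodic_def by blast
qed

section \<open>Rational starting points\<close>

text \<open>The successor of p / q is p / (q - 2 p), (q - 2 p) / p or (2 p - q) / p according to the
  digit. No denominator exceeds q, so the initial one bounds them all; fractions need not be
  reduced.\<close>

lemma rational_orbit_finite:
  assumes orb: "is_orbit d t" and rat: "t 0 \<in> \<rat>"
  shows "finite (range t)"
proof -
  note o = is_orbitD[OF orb]
  obtain N p0 :: int where N: "N > 0" "t 0 = of_int p0 / of_int N"
    using rat by (metis Rats_cases')
  have frac: "\<exists>p q :: int. 0 < q \<and> q \<le> N \<and> t n = of_int p / of_int q" for n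
  proof (induction n)
    case 0
    then show ?case using N by blast
  next
    case (Suc n)
    then obtain p q :: int where q: "0 < q" "q \<le> N" and t: "t n = of_int p / of_int q" by blast
    define s where "s = t (Suc n)"
    have s: "s \<in> {0..1}" "t n = inv_branch (d n) s" using o unfolding s_def by blast+
    have pq: "0 \<le> p" "p \<le> q" using o(2)[of n] q by (auto simp: t zero_le_divide_iff)
    consider "d n = 1" | "d n = 2" | "d n = 3" using o(1)[of n] by auto
    then show ?case
    proof cases
      case 1
      then have "of_int p / of_int q = s / (1 + 2 * s)" using s t by (simp add: inv_branch_def)
      then have e: "of_int p * (1 + 2 * s) = s * of_int q"
        using s(1) q by (simp add: frac_eq_eq)
      \<comment> \<open>This yields 3 p \<le> q, which makes the new denominator q - 2 p
        positive.\<close>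
      have "t n \<le> 1/3" using inv_branch_bounds(1)[OF s(1)] s(2) 1 by simp
      then have "3 * real_of_int p \<le> real_of_int q" using q t by (simp add: field_simps)
      then have qp: "q - 2 * p > 0" using q by linarith
      then have "real_of_int q - 2 * real_of_int p > 0" by linarith
      then have "s = of_int p / of_int (q - 2 * p)"
        using e by (simp add: field_simps)
      moreover have "q - 2 * p \<le> N" using pq q by linarith
      ultimately show ?thesis using qp unfolding s_def by blast
    next
      case 2
      then have "of_int p / of_int q = 1 / (s + 2)" using s t by (simp add: inv_branch_def)
      then have e: "of_int p * (s + 2) = of_int q"
        using s(1) q by (simp add: frac_eq_eq)
      then have "p \<noteq> 0" using q by auto
      then have "p > 0" using pq by simp
      then have "s = of_int (q - 2 * p) / of_int p"
        using e by (simp add: field_simps)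
      then show ?thesis using \<open>p > 0\<close> pq q unfolding s_def by (metis order_trans)
    next
      case 3
      then have "of_int p / of_int q = 1 / (2 - s)" using s t by (simp add: inv_branch_def)
      then have e: "of_int p * (2 - s) = of_int q"
        using s(1) q by (simp add: frac_eq_eq)
      then have "p \<noteq> 0" using q by auto
      then have "p > 0" using pq by simp
      then have "s = of_int (2 * p - q) / of_int p"
        using e by (simp add: field_simps)
      then show ?thesis using \<open>p > 0\<close> pq q unfolding s_def by (metis order_trans)
    qed
  qed
  have "\<exists>p q :: int. 0 < q \<and> q \<le> N \<and> 0 \<le> p \<and> p \<le> N \<and> t n = of_int p / of_int q" for n
  proof -
    obtain p q :: int where q: "0 < q" "q \<le> N" "t n = of_int p / of_int q"
      using frac by blast
    then have "0 \<le> p" "p \<le> q" using o(2)[of n] by (auto simp: zero_le_divide_iff)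
    then show ?thesis using q by (meson order_trans)
  qed
  then have "range t \<subseteq> (\<lambda>(p, q). real_of_int p / real_of_int q) ` ({0..N} \<times> {0..N})"
    by (force simp: image_iff)
  then show ?thesis by (rule finite_subset) auto
qed

section \<open>Conjugates and quadratic starting points\<close>

text \<open>Vieta's relations for an integral polynomial a X^2 + b X + c of discriminant
  \<open>\<Delta>\<close> with roots \<open>t\<close> and \<open>u\<close>. Only the discriminant is
  exposed, since it is the invariant along the orbit.\<close>

definition conj_roots :: "int \<Rightarrow> real \<Rightarrow> real \<Rightarrow> bool" where
  "conj_roots \<Delta> t u \<longleftrightarrow> (\<exists>a b c :: int. a \<noteq> 0 \<and> b\<^sup>2 - 4 * a * c = \<Delta> \<and>
     of_int b = - (of_int a * (t + u)) \<and> of_int c = of_int a * t * u)"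

lemma conj_roots_irrational:
  assumes "conj_roots \<Delta> t u" "t \<notin> \<rat>"
  shows "u \<notin> \<rat>"
proof
  assume u: "u \<in> \<rat>"
  obtain a b :: int where "a \<noteq> 0" "of_int b = - (of_int a * (t + u))"
    using assms by (auto simp: conj_roots_def)
  then have "t = - of_int b / of_int a - u" by (simp add: field_simps)
  then show False using u assms(2) by simp
qed

lemma inv_branch_Rats: "s \<in> \<rat> \<Longrightarrow> inv_branch k s \<in> \<rat>"
  by (simp add: inv_branch_def)

text \<open>Substituting a branch is an integral change of variable of determinant 1 or -1, which
  preserves the discriminant. The new coefficients are (a + 2 b + 4 c, b + 4 c, c) for branch 1, the
  same in reverse order for branch 2, and that reversal with the middle sign changed for branch
  3.\<close>

lemma conj_roots_step:
  assumes cr: "conj_roots \<Delta> (inv_branch k s) u" and irr: "inv_branch k s \<notin> \<rat>"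
    and s: "s \<in> {0..1}" and k: "k \<in> {1, 2, 3}"
  shows "\<exists>u'. conj_roots \<Delta> s u' \<and> u = inv_branch k u'"
proof -
  define t where "t = inv_branch k s"
  obtain a b c :: int where a: "a \<noteq> 0" and disc: "b\<^sup>2 - 4 * a * c = \<Delta>"
    and b: "of_int b = - (of_int a * (t + u))" and c: "of_int c = of_int a * t * u"
    using cr unfolding conj_roots_def t_def by blast
  have ui: "u \<notin> \<rat>" using conj_roots_irrational cr irr by blast
  have "(1/2 :: real) \<in> \<rat>" by simp
  \<comment> \<open>The values 0 and 1/2 are the poles of the forward branches, so neither root may
    equal them.\<close>
  then have nr: "t \<noteq> 0" "t \<noteq> 1/2" "u \<noteq> 0" "u \<noteq> 1/2"
    using ui irr Rats_0 unfolding t_def by metis+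
  then have nz: "t \<noteq> 0" "u \<noteq> 0" "1 - 2 * t \<noteq> 0" "1 - 2 * u \<noteq> 0" by auto
  \<comment> \<open>This is four times the value of the polynomial at 1/2.\<close>
  have e: "real_of_int (a + 2 * b + 4 * c) = of_int a * (1 - 2 * t) * (1 - 2 * u)"
    by (simp add: b c algebra_simps)
  have "a + 2 * b + 4 * c \<noteq> 0" 
    using e nz a by (metis mult_eq_0_iff of_int_0 of_int_eq_0_iff)
  have "c \<noteq> 0" using c nz a by (metis mult_eq_0_iff of_int_0 of_int_eq_0_iff)
  have disc': "(b + 4 * c)\<^sup>2 - 4 * (a + 2 * b + 4 * c) * c = \<Delta>"
    unfolding disc[symmetric] by (simp add: power2_eq_square algebra_simps)
  consider "k = 1" | "k = 2" | "k = 3" using k by auto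
  then show ?thesis
  proof cases
    case 1
    define u' where "u' = u / (1 - 2 * u)"
    have st: "s = t / (1 - 2 * t)" using s nz 1 by (simp add: t_def inv_branch_def field_simps)
    have "1 + 2 * u' = 1 / (1 - 2 * u)" using nz by (simp add: u'_def field_simps)
    then have "u = inv_branch k u'" using nz by (simp add: 1 inv_branch_def u'_def)
    moreover have "of_int (b + 4 * c) = - (of_int (a + 2 * b + 4 * c) * (s + u'))"
      unfolding e st u'_def using nz by (simp add: b c divide_simps) (simp add: algebra_simps)
    moreover have "of_int c = of_int (a + 2 * b + 4 * c) * s * u'"
      unfolding e st u'_def using nz by (simp add: c)
    ultimately show ?thesis using disc' \<open>a + 2 * b + 4 * c \<noteq> 0\<close>
      unfolding conj_roots_def by blast
  next
    case 2
    define u' where "u' = (1 - 2 * u) / u"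
    have st: "s = (1 - 2 * t) / t" using s nz 2 by (simp add: t_def inv_branch_def field_simps)
    have "u' + 2 = 1 / u" using nz by (simp add: u'_def field_simps)
    then have "u = inv_branch k u'" using nz by (simp add: 2 inv_branch_def)
    moreover have "of_int (b + 4 * c) = - (of_int c * (s + u'))"
      unfolding st u'_def using nz by (simp add: b c divide_simps) (simp add: algebra_simps)
    moreover have "of_int (a + 2 * b + 4 * c) = of_int c * s * u'"
      unfolding e st u'_def using nz by (simp add: c)
    moreover have "(b + 4 * c)\<^sup>2 - 4 * c * (a + 2 * b + 4 * c) = \<Delta>"
      using disc' by (simp add: algebra_simps)
    ultimately show ?thesis using \<open>c \<noteq> 0\<close> unfolding conj_roots_def by blast
  next
    case 3
    define u' where "u' = (2 * u - 1) / u"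
    have st: "s = (2 * t - 1) / t" using s nz 3 by (simp add: t_def inv_branch_def field_simps)
    have "2 - u' = 1 / u" using nz by (simp add: u'_def field_simps)
    then have "u = inv_branch k u'" using nz by (simp add: 3 inv_branch_def)
    moreover have "of_int (- b - 4 * c) = - (of_int c * (s + u'))"
      unfolding st u'_def using nz by (simp add: b c divide_simps) (simp add: algebra_simps)
    moreover have "of_int (a + 2 * b + 4 * c) = of_int c * s * u'"
      unfolding e st u'_def using nz by (simp add: c divide_simps) (simp add: algebra_simps)
    moreover have "(- b - 4 * c)\<^sup>2 - 4 * c * (a + 2 * b + 4 * c) = \<Delta>"
      using disc' by (simp add: algebra_simps power2_eq_square)
    ultimately show ?thesis using \<open>c \<noteq> 0\<close> unfolding conj_roots_def by blast
  qed
qed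

lemma finite_quadratic_roots:
  fixes a b c :: real
  assumes "a \<noteq> 0"
  shows "finite {x. a * x\<^sup>2 + b * x + c = 0}"
proof -
  have "{x. a * x\<^sup>2 + b * x + c = 0} \<subseteq>
      {(- b + sqrt (discrim a b c)) / (2 * a), (- b - sqrt (discrim a b c)) / (2 * a)}"
    using discriminant_iff[OF assms, of _ b c] by auto
  then show ?thesis by (rule finite_subset) simp
qed

text \<open>The form (a + b + c) X^2 + (b + 2 c) X Y + c Y^2, obtained from a t^2 + b t + c by
  t = X / (X + Y), has the same discriminant; its outer coefficients have opposite signs when
  exactly one root lies in the unit interval, so the discriminant bounds all coefficients.\<close>

lemma finite_separated_roots:
  "finite {t. 0 < t \<and> t < 1 \<and> (\<exists>u. u \<notin> {0..1} \<and> conj_roots \<Delta> t u)}" (is "finite ?S")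
proof -
  \<comment> \<open>With \<open>e\<close> and \<open>m\<close> as defined below, b = m - 2 c and a =
    e - m + c, so bounds by \<open>\<Delta>\<close> on \<open>c\<close>, \<open>e\<close> and
    \<open>m\<close> keep all coefficients within 3 |\<Delta>|; the factor 5 is ample.\<close>
  define F where "F = {-(5 * \<bar>\<Delta>\<bar>)..5 * \<bar>\<Delta>\<bar>}"
  have "?S \<subseteq> (\<Union>(a, b, c) \<in> {(a, b, c). a \<in> F \<and> b \<in> F \<and> c \<in> F \<and> a \<noteq> 0}.
    {x. of_int a * x\<^sup>2 + of_int b * x + of_int c = 0})"
  proof safe
    fix t u assume t: "0 < t" "t < 1" and u: "u \<notin> {0..1}" and "conj_roots \<Delta> t u"
    then obtain a b c :: int where a: "a \<noteq> 0" and disc: "b\<^sup>2 - 4 * a * c = \<Delta>"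
      and b: "of_int b = - (of_int a * (t + u))" and c: "of_int c = of_int a * t * u"
      unfolding conj_roots_def by blast
    define e m where "e = a + b + c" and "m = b + 2 * c"
    have "u * (1 - u) < 0" using u by (auto simp: mult_less_0_iff)
    moreover have "(of_int a)\<^sup>2 * (t * (1 - t)) > 0" using a t by simp
    ultimately have "(of_int a)\<^sup>2 * (t * (1 - t)) * (u * (1 - u)) < 0"
      by (rule mult_pos_neg[rotated])
    moreover have "real_of_int (c * e) = (of_int a)\<^sup>2 * (t * (1 - t)) * (u * (1 - u))"
      by (simp add: e_def b c power2_eq_square algebra_simps)
    ultimately have ce: "c * e < 0" by linarith
    have disc': "m\<^sup>2 - 4 * (c * e) = \<Delta>"
      unfolding disc[symmetric] m_def e_def by (simp add: power2_eq_square algebra_simps)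
    have "\<bar>c\<bar> * 1 \<le> \<bar>c\<bar> * \<bar>e\<bar>" "1 * \<bar>e\<bar> \<le> \<bar>c\<bar> * \<bar>e\<bar>"
      using ce by (intro mult_left_mono mult_right_mono; cases "c = 0"; cases "e = 0"; simp)+
    moreover have "\<bar>c\<bar> * \<bar>e\<bar> = - (c * e)" using ce by (simp add: abs_mult[symmetric])
    moreover have "m\<^sup>2 \<ge> 0" by simp
    moreover have "\<bar>m\<bar> \<le> m\<^sup>2"
      by (cases "m = 0") (use mult_left_mono[of 1 "\<bar>m\<bar>" "\<bar>m\<bar>"] in \<open>auto simp: power2_eq_square\<close>)
    ultimately have "\<bar>c\<bar> \<le> \<Delta>" "\<bar>e\<bar> \<le> \<Delta>" "\<bar>m\<bar> \<le> \<Delta>" using disc' ce by linarith+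
    then have "a \<in> F" "b \<in> F" "c \<in> F" unfolding F_def e_def m_def by auto
    moreover have "of_int a * t\<^sup>2 + of_int b * t + of_int c = 0"
      by (simp add: b c power2_eq_square algebra_simps)
    ultimately show "t \<in> (\<Union>(a, b, c) \<in> {(a, b, c). a \<in> F \<and> b \<in> F \<and> c \<in> F \<and> a \<noteq> 0}.
      {x. of_int a * x\<^sup>2 + of_int b * x + of_int c = 0})" using a by auto
  qed
  moreover have "finite {(a, b, c). a \<in> F \<and> b \<in> F \<and> c \<in> F \<and> a \<noteq> 0}"
    by (rule finite_subset[of _ "F \<times> F \<times> F"]) (auto simp: F_def)
  then have "finite (\<Union>(a, b, c) \<in> {(a, b, c). a \<in> F \<and> b \<in> F \<and> c \<in> F \<and> a \<noteq> 0}.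
      {x::real. of_int a * x\<^sup>2 + of_int b * x + of_int c = 0})"
    by (rule finite_UN_I) (auto intro!: finite_quadratic_roots)
  ultimately show ?thesis by (rule finite_subset)
qed

lemma quadratic_orbit_finite:
  assumes orb: "is_orbit d t" and irr: "t 0 \<notin> \<rat>" and cr: "conj_roots \<Delta> (t 0) u0"
    and ne: "u0 \<noteq> t 0"
  shows "\<exists>m. finite (t ` {m..})"
proof -
  note o = is_orbitD[OF orb]
  have irr: "t n \<notin> \<rat>" for n
  proof (induction n)
    case (Suc n)
    then show ?case using o(3)[of n] inv_branch_Rats by metis
  qed (rule irr)
  \<comment> \<open>The conjugate orbit is built by dependent choice from
    \<open>conj_roots_step\<close>; the clause for n = 0 pins its start to
    \<open>u0\<close>.\<close>
  have "\<exists>u. \<forall>n. (conj_roots \<Delta> (t n) (u n) \<and> (n = 0 \<longrightarrow> u n = u0)) \<and>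
      u n = inv_branch (d n) (u (Suc n))"
  proof (rule dependent_nat_choice)
    show "\<exists>x. conj_roots \<Delta> (t 0) x \<and> (0 = 0 \<longrightarrow> x = u0)" using cr by blast
  next
    fix x n assume "conj_roots \<Delta> (t n) x \<and> (n = 0 \<longrightarrow> x = u0)"
    then show "\<exists>y. (conj_roots \<Delta> (t (Suc n)) y \<and> (Suc n = 0 \<longrightarrow> y = u0)) \<and>
        x = inv_branch (d n) y"
      using conj_roots_step[of \<Delta> "d n" "t (Suc n)" x] o irr by (metis nat.distinct(1))
  qed
  then obtain u where u: "\<And>n. conj_roots \<Delta> (t n) (u n)" "u 0 = u0"
    "\<And>n. u n = inv_branch (d n) (u (Suc n))" by metis
  have "\<exists>m. u m \<notin> {0..1}"
  proof (rule ccontr)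
    assume "\<not> ?thesis"
    then have "is_orbit d u" using o u unfolding is_orbit_def by blast
    then show False using is_orbit_unique[OF orb] ne u(2) by metis
  qed
  then obtain m where m: "u m \<notin> {0..1}" by blast
  \<comment> \<open>The inverse branches preserve [0, 1], so a return of \<open>u (Suc n)\<close> to
    the interval would put \<open>u n\<close> there too.\<close>
  have out: "u n \<notin> {0..1}" if "n \<ge> m" for n
    using that
  proof (induction rule: dec_induct)
    case (step n)
    then show ?case using inv_branch_in_unit[OF _ o(1)[of n], of "u (Suc n)"] u(3)[of n] by metis
  qed (rule m)
  have "0 < t n \<and> t n < 1" for n
    using o(2)[of n] irr[of n] Rats_0 Rats_1 by (metis atLeastAtMost_iff less_eq_real_def)
  then have "t ` {m..} \<subseteq> {t. 0 < t \<and> t < 1 \<and> (\<exists>u. u \<notin> {0..1} \<and> conj_roots \<Delta> t u)}"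
    using out u(1) by blast
  then show ?thesis using finite_separated_roots finite_subset by blast
qed

lemma rat_adjoin_sqrt_conj_roots:
  assumes "x \<in> rat_adjoin_sqrt D" "x \<notin> \<rat>"
  shows "\<exists>\<Delta> u. conj_roots \<Delta> x u \<and> u \<noteq> x"
proof -
  obtain p q where x: "x = p + q * sqrt (real D)" and r: "p \<in> \<rat>" "q \<in> \<rat>"
    using assms by (auto simp: rat_adjoin_sqrt_def)
  obtain i M :: int where M: "M > 0" "p = of_int i / of_int M" using r by (metis Rats_cases')
  obtain j N :: int where N: "N > 0" "q = of_int j / of_int N" using r by (metis Rats_cases')
  define u where "u = p - q * sqrt (real D)"
  have "q * sqrt (real D) \<noteq> 0" using assms(2) r x by (metis add.right_neutral)
  then have ne: "u \<noteq> x" by (simp add: u_def x)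
  have S: "sqrt (real D) * (sqrt (real D) * z) = real D * z" for z
    by (simp flip: mult.assoc)
  \<comment> \<open>The polynomial with roots p + q sqrt D and p - q sqrt D, multiplied by the
    square of \<open>M * N\<close>.\<close>
  define a b c :: int where "a = M\<^sup>2 * N\<^sup>2" and "b = - (2 * i * M * N\<^sup>2)"
    and "c = i\<^sup>2 * N\<^sup>2 - j\<^sup>2 * M\<^sup>2 * int D"
  have "a \<noteq> 0" using M N by (simp add: a_def)
  moreover have "of_int b = - (of_int a * (x + u))"
    using M N by (simp add: x u_def a_def b_def power2_eq_square)
  moreover have "of_int c = of_int a * x * u"
  proof -
    have "of_int i = p * of_int M" "of_int j = q * of_int N" using M N by simp_all
    then show ?thesis by (simp add: x u_def a_def c_def power2_eq_square algebra_simps S)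
  qed
  ultimately show ?thesis using ne unfolding conj_roots_def by blast
qed

lemma quadratic_imp_eventually_periodic:
  assumes orb: "is_orbit d t" and t: "t 0 \<in> rat_adjoin_sqrt D"
  shows "eventually_periodic d"
proof (cases "t 0 \<in> \<rat>")
  case True
  have "t ` {0..} \<subseteq> range t" by blast
  then have "finite (t ` {0..})"
    using rational_orbit_finite[OF orb True] finite_subset by blast
  then show ?thesis by (rule finite_orbit_imp_eventually_periodic[OF orb])
next
  case False
  then show ?thesis
    using rat_adjoin_sqrt_conj_roots[OF t] quadratic_orbit_finite[OF orb]
      finite_orbit_imp_eventually_periodic[OF orb] by blast
qed

section \<open>Half-angle coordinate on the quarter circle\<close>

text \<open>For P = (cos \<theta>, sin \<theta>) this is tan (\<theta> / 2), the stereographic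
  projection from (-1, 0).\<close>

definition half_tan :: "real \<times> real \<Rightarrow> real" where
  "half_tan P = snd P / (1 + fst P)"

lemma quarter_circle_half_tan:
  assumes "(x, y) \<in> quarter_circle"
  defines "t \<equiv> half_tan (x, y)"
  shows "t \<in> {0..1}" "x = (1 - t\<^sup>2) / (1 + t\<^sup>2)" "y = 2 * t / (1 + t\<^sup>2)"
proof -
  have xy: "x \<ge> 0" "y \<ge> 0" "x\<^sup>2 + y\<^sup>2 = 1" using assms(1) by (auto simp: quarter_circle_def)
  have y1: "y \<le> 1"
  proof (rule power2_le_imp_le)
    show "y\<^sup>2 \<le> 1\<^sup>2" using xy(3) zero_le_power2[of x] unfolding power_one by linarith
  qed simp
  show "t \<in> {0..1}" using xy y1 by (simp add: t_def half_tan_def)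
  have "1 + t\<^sup>2 = ((1 + x)\<^sup>2 + y\<^sup>2) / (1 + x)\<^sup>2"
    using xy by (simp add: t_def half_tan_def power_divide add_divide_distrib)
  also have "(1 + x)\<^sup>2 + y\<^sup>2 = 2 * (1 + x)" using xy(3) by (simp add: power2_eq_square algebra_simps)
  finally have p: "1 + t\<^sup>2 = 2 / (1 + x)"
    unfolding power2_eq_square using xy by (simp del: distrib_left_numeral)
  then have t2: "t\<^sup>2 = 2 / (1 + x) - 1" by simp
  show "x = (1 - t\<^sup>2) / (1 + t\<^sup>2)" unfolding p unfolding t2 using xy by (simp add: field_simps)
  show "y = 2 * t / (1 + t\<^sup>2)" unfolding p using xy by (simp add: t_def half_tan_def)
qed

text \<open>In the coordinate \<open>t\<close> the numerators of the map factor, and on [0, 1] their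
  signs change only at t = 1/3 and t = 1/2. These are the digit boundaries x = 4/5 and x = 3/5, so
  each digit resolves the absolute values into one Moebius branch.\<close>

lemma half_tan_romik_map:
  assumes P: "P \<in> quarter_circle" and k: "is_romik_digit P k"
  shows "k \<in> {1, 2, 3}" "half_tan P = inv_branch k (half_tan (romik_map P))"
proof -
  show kk: "k \<in> {1, 2, 3}" using k by (cases P) (auto simp: is_romik_digit_def)
  obtain x y where xy: "P = (x, y)" by (cases P)
  define t where "t = half_tan P"
  have t: "t \<in> {0..1}" and x: "x = (1 - t\<^sup>2) / (1 + t\<^sup>2)" and y: "y = 2 * t / (1 + t\<^sup>2)"
    using quarter_circle_half_tan[of x y] P by (auto simp: xy t_def)
  define w where "w = 1 + t\<^sup>2"
  have w: "w > 0" unfolding w_def by (simp add: add_pos_nonneg)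
  have n1: "2 - x - 2 * y = (3 * t - 1) * (t - 1) / w"
    using w unfolding x y w_def[symmetric]
    by (simp add: field_simps) (simp add: w_def power2_eq_square algebra_simps)
  have n2: "2 - 2 * x - y = 2 * t * (2 * t - 1) / w"
    using w unfolding x y w_def[symmetric]
    by (simp add: field_simps) (simp add: w_def power2_eq_square algebra_simps)
  have n3: "3 - 2 * x - 2 * y = (5 * t\<^sup>2 - 4 * t + 1) / w"
    using w unfolding x y w_def[symmetric]
    by (simp add: field_simps) (simp add: w_def power2_eq_square algebra_simps)
  have "5 * t\<^sup>2 - 4 * t + 1 = (2 * t - 1)\<^sup>2 + t\<^sup>2" by (simp add: power2_eq_square algebra_simps)
  also have "\<dots> > 0" by (cases "t = 0") (auto intro: add_nonneg_pos)
  finally have q: "5 * t\<^sup>2 - 4 * t + 1 > 0" .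
  define v where "v = 5 * t\<^sup>2 - 4 * t + 1"
  have R: "romik_map P = (\<bar>(3 * t - 1) * (t - 1)\<bar> / v, \<bar>2 * t * (2 * t - 1)\<bar> / v)"
    unfolding xy romik_map_def split n1 n2 n3 v_def using w by simp
  have v: "v > 0" using q v_def by simp
  have "1 + \<bar>(3 * t - 1) * (t - 1)\<bar> / v = (v + \<bar>(3 * t - 1) * (t - 1)\<bar>) / v"
    using v by (simp add: field_simps)
  then have T: "half_tan (romik_map P) = \<bar>2 * t * (2 * t - 1)\<bar> / (v + \<bar>(3 * t - 1) * (t - 1)\<bar>)"
    using v unfolding R half_tan_def by simp
  have small: "half_tan (romik_map P) = t / (1 - 2 * t)" if "t \<le> 1/3"
  proof -
    have "(3 * t - 1) * (t - 1) \<ge> 0" using that by (intro mult_nonpos_nonpos) auto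
    then have "v + \<bar>(3 * t - 1) * (t - 1)\<bar> = (2 * (1 - 2 * t)) * (1 - 2 * t)"
      by (simp add: v_def power2_eq_square algebra_simps)
    moreover have "\<bar>2 * t * (2 * t - 1)\<bar> = (2 * (1 - 2 * t)) * t"
      using that t by (simp add: abs_mult)
    ultimately show ?thesis using that unfolding T by simp
  qed
  \<comment> \<open>The remaining absolute value separates digits 2 and 3, which share this
    formula.\<close>
  have big: "half_tan (romik_map P) = \<bar>2 * t - 1\<bar> / t" if "t \<ge> 1/3"
  proof -
    have "(3 * t - 1) * (t - 1) \<le> 0" using that t by (intro mult_nonneg_nonpos) auto
    then have "v + \<bar>(3 * t - 1) * (t - 1)\<bar> = (2 * t) * t"
      by (simp add: v_def power2_eq_square algebra_simps)
    moreover have "\<bar>2 * t * (2 * t - 1)\<bar> = (2 * t) * \<bar>2 * t - 1\<bar>"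
      using that t by (simp add: abs_mult)
    ultimately show ?thesis using that unfolding T by simp
  qed
  have x45: "4/5 \<le> x \<longleftrightarrow> t \<le> 1/3" "x \<le> 4/5 \<longleftrightarrow> t \<ge> 1/3"
  proof -
    have *: "x - 4/5 = (1 - 3 * t) * (1 + 3 * t) / (5 * w)"
      using w unfolding x w_def[symmetric]
    by (simp add: field_simps) (simp add: w_def power2_eq_square algebra_simps)
    have "1 + 3 * t > 0" using t by auto
    then have "0 \<le> x - 4/5 \<longleftrightarrow> 0 \<le> 1 - 3 * t" "x - 4/5 \<le> 0 \<longleftrightarrow> 1 - 3 * t \<le> 0"
      unfolding * using w
      by (auto simp: zero_le_divide_iff divide_le_0_iff zero_le_mult_iff mult_le_0_iff)
    then show "4/5 \<le> x \<longleftrightarrow> t \<le> 1/3" "x \<le> 4/5 \<longleftrightarrow> t \<ge> 1/3" by auto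
  qed
  have x35: "3/5 \<le> x \<longleftrightarrow> t \<le> 1/2" "x \<le> 3/5 \<longleftrightarrow> t \<ge> 1/2"
  proof -
    have *: "x - 3/5 = 2 * (1 - 2 * t) * (1 + 2 * t) / (5 * w)"
      using w unfolding x w_def[symmetric]
    by (simp add: field_simps) (simp add: w_def power2_eq_square algebra_simps)
    have "1 + 2 * t > 0" using t by auto
    then have "0 \<le> x - 3/5 \<longleftrightarrow> 0 \<le> 1 - 2 * t" "x - 3/5 \<le> 0 \<longleftrightarrow> 1 - 2 * t \<le> 0"
      unfolding * using w
      by (auto simp: zero_le_divide_iff divide_le_0_iff zero_le_mult_iff mult_le_0_iff)
    then show "3/5 \<le> x \<longleftrightarrow> t \<le> 1/2" "x \<le> 3/5 \<longleftrightarrow> t \<ge> 1/2" by auto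
  qed
  \<comment> \<open>Closed inequalities cover both admissible digits at the boundary points.\<close>
  consider "k = 1" "4/5 \<le> x" | "k = 2" "3/5 \<le> x" "x \<le> 4/5" | "k = 3" "x \<le> 3/5"
    using k unfolding xy is_romik_digit_def by auto
  then have "t = inv_branch k (half_tan (romik_map P))"
  proof cases
    case 1
    then have l: "t \<le> 1/3" using x45 by simp
    then have "1 + 2 * (t / (1 - 2 * t)) = 1 / (1 - 2 * t)" by (simp add: field_simps)
    then show ?thesis using l small[OF l] by (simp add: inv_branch_def 1)
  next
    case 2
    then have l: "t \<ge> 1/3" "t \<le> 1/2" using x45 x35 by auto
    then have "\<bar>2 * t - 1\<bar> / t + 2 = 1 / t" by (simp add: field_simps)
    then show ?thesis using big[OF l(1)] by (simp add: inv_branch_def 2)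
  next
    case 3
    then have l: "t \<ge> 1/3" "t \<ge> 1/2" using x35 by auto
    then have "2 - \<bar>2 * t - 1\<bar> / t = 1 / t" by (simp add: field_simps)
    then show ?thesis using big[OF l(1)] by (simp add: inv_branch_def 3)
  qed
  then show "half_tan P = inv_branch k (half_tan (romik_map P))" by (simp add: t_def)
qed

text \<open>Expansions are indexed from 1 and orbits from 0, hence the shifted digit
  \<open>d (Suc n)\<close>.\<close>

lemma romik_expansion_is_orbit:
  assumes P: "P \<in> quarter_circle" and d: "is_romik_expansion P d"
  shows "is_orbit (\<lambda>n. d (Suc n)) (\<lambda>n. half_tan ((romik_map ^^ n) P))"
  unfolding is_orbit_def
proof (rule allI)
  fix n
  have q: "(romik_map ^^ n) P \<in> quarter_circle"
    by (induction n) (simp_all add: P romik_map_quarter_circle)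
  have "is_romik_digit ((romik_map ^^ n) P) (d (Suc n))"
    using d unfolding is_romik_expansion_def by (metis diff_Suc_1 le_add1 plus_1_eq_Suc)
  then show "d (Suc n) \<in> {1, 2, 3} \<and> half_tan ((romik_map ^^ n) P) \<in> {0..1} \<and>
      half_tan ((romik_map ^^ n) P) =
        inv_branch (d (Suc n)) (half_tan ((romik_map ^^ Suc n) P))"
    using half_tan_romik_map[OF q] quarter_circle_half_tan(1) q
    by (metis comp_apply funpow.simps(2) surj_pair)
qed

lemma eventually_periodic_Suc:
  "eventually_periodic (\<lambda>n. d (Suc n)) \<longleftrightarrow> eventually_periodic d"
proof
  assume "eventually_periodic (\<lambda>n. d (Suc n))"
  then obtain l k where k: "k \<ge> 1" "\<forall>j>l. d (Suc (j + k)) = d (Suc j)"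
    unfolding eventually_periodic_def by blast
  have "d (j + k) = d j" if "j > Suc l" for j
    using k(2) that by (cases j) auto
  then show "eventually_periodic d" using k(1) unfolding eventually_periodic_def by blast
next
  assume "eventually_periodic d"
  then obtain l k where k: "k \<ge> 1" "\<forall>j>l. d (j + k) = d j"
    unfolding eventually_periodic_def by blast
  have "d (Suc (j + k)) = d (Suc j)" if "j > l" for j
    using k(2)[rule_format, of "Suc j"] that by simp
  then show "eventually_periodic (\<lambda>n. d (Suc n))"
    using k(1) unfolding eventually_periodic_def by blast
qed

text \<open>The coordinate change and its inverse are rational functions with rational
  coefficients.\<close>

lemma half_tan_rat_adjoin_sqrt:
  assumes "(x, y) \<in> quarter_circle"
  shows "half_tan (x, y) \<in> rat_adjoin_sqrt D \<longleftrightarrow>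
    x \<in> rat_adjoin_sqrt D \<and> y \<in> rat_adjoin_sqrt D"
proof
  assume t: "half_tan (x, y) \<in> rat_adjoin_sqrt D"
  have "(1 - (half_tan (x, y))\<^sup>2) / (1 + (half_tan (x, y))\<^sup>2) \<in> rat_adjoin_sqrt D"
    "2 * half_tan (x, y) / (1 + (half_tan (x, y))\<^sup>2) \<in> rat_adjoin_sqrt D"
    unfolding power2_eq_square using t by (auto intro!: rat_adjoin_sqrt_field intro: Rats_subset_rat_adjoin_sqrt)
  then show "x \<in> rat_adjoin_sqrt D \<and> y \<in> rat_adjoin_sqrt D"
    using quarter_circle_half_tan(2,3)[OF assms] by metis
next
  assume "x \<in> rat_adjoin_sqrt D \<and> y \<in> rat_adjoin_sqrt D"
  then show "half_tan (x, y) \<in> rat_adjoin_sqrt D"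
    unfolding half_tan_def by (auto intro!: rat_adjoin_sqrt_field intro: Rats_subset_rat_adjoin_sqrt)
qed

theorem theorem3p1:
  fixes \<alpha> \<beta> :: real and d :: "nat \<Rightarrow> nat"
  assumes "(\<alpha>, \<beta>) \<in> quarter_circle"
    and "is_romik_expansion (\<alpha>, \<beta>) d"
  shows "eventually_periodic d \<longleftrightarrow>
    (\<exists>D::nat. D > 0 \<and> squarefree D \<and> \<alpha> \<in> rat_adjoin_sqrt D \<and> \<beta> \<in> rat_adjoin_sqrt D)"
proof -
  have orb: "is_orbit (\<lambda>n. d (Suc n)) (\<lambda>n. half_tan ((romik_map ^^ n) (\<alpha>, \<beta>)))"
    using assms by (rule romik_expansion_is_orbit)
  have "eventually_periodic (\<lambda>n. d (Suc n)) \<longleftrightarrow>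
      (\<exists>D. D > 0 \<and> squarefree D \<and> half_tan (\<alpha>, \<beta>) \<in> rat_adjoin_sqrt D)"
    using eventually_periodic_imp_quadratic[OF orb] quadratic_imp_eventually_periodic[OF orb]
    by auto
  then show ?thesis
    by (simp add: eventually_periodic_Suc half_tan_rat_adjoin_sqrt[OF assms(1)])
qed

end
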